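(* Let $b_1>1$ and $c>0$, and let $\mathcal U=(t_0,z_0,Y_0)$ be a point of the sonic' surface $Son'\subset M\setminus\Pi$ (subject to the standing assumptions given in the context). Then $\mathcal U$ satisfies condition L3, namely $$s(\mathcal U'_s)<s(\mathcal U)<s(\mathcal U'_f),$$ if and only if $z_0^2<\dfrac{1}{b_1+1}$, that is, $-\dfrac{1}{\sqrt{b_1+1}}<z_0<\dfrac{1}{\sqrt{b_1+1}}$.
   Context: Setting. Let $F=(f,g):\mathbb R^2\to\mathbb R^2$ with $f(u,v)=\frac{v^2}{2}+(b_1+1)\frac{u^2}{2}+a_1u+a_2v$ and $g(u,v)=uv+a_3u+a_4v$, where $a_1,\dots,a_4$ are real constants, $b_1>1$ and $c:=a_3-a_2>0$. For $W=(u,v)$, $W'=(u',v')$ put $U=\frac{u+u'}2$, $V=\frac{v+v'}2$, $X=u-u'$, $Y=v-v'$, $\tilde U=b_1U+a_1-a_4$, $\tilde V=V+a_2$, $V_1=V+a_3=\tilde V+c$. Wave manifold. $M$ is the 3-manifold obtained by blowing up $\{(W,W',s): F(W)-F(W')=s(W-W')\}$ along the diagonal $W=W'$: it is the set of $(U,V,X,Y)$ together with a direction $Z\in\mathbb{RP}^1$ such that $Y=ZX$ and $(1-Z^2)\tilde V-Z\tilde U+c=0$ (suitably interpreted at $Z=\infty$). $\Pi\subset M$ is the plane $Z=0$. On $M\setminus\Pi$ put $z=1/Z$, so $X=zY$ and the equation of $M$ becomes $(z^2-1)V_1-z\tilde U+c=0$. Coordinates $(t,z,Y)\in\mathbb R^3$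 on $M\setminus\Pi$ are given by $$\tilde U=\frac{2cz}{z^2+1}+ct(z^2-1),\qquad V_1=\frac{c}{z^2+1}+ctz .$$ The shock speed $s$ is the function on $M$ extending the value of $s$ in $F(W)-F(W')=s(W-W')$; on $M\setminus\Pi$ it equals, up to an additive constant, $$\frac{\tilde U}{b_1}+zV_1=\frac{c\big((b_1+1)tz^4+b_1tz^2+(b_1+2)z-t\big)}{b_1(z^2+1)}.$$ Curves and surfaces. A Hugoniot curve is a set $\{u=\text{const},\,v=\text{const}\}$ in $M$, equivalently $2\tilde U+b_1X=k$, $2\tilde V+ZX=l$ with $k,l$ constant. A Hugoniot' curve is a set $\{u'=\text{const},\,v'=\text{const}\}$ in $M$, equivalently $2\tilde U-b_1X=k$, $2\tilde V-ZX=l$ with $k,l$ constant. The curves through $\mathcal U$ are denoted $sh(\mathcal U)$ and $sh'(\mathcal U)$ respectively. The characteristic surface is $\mathcal C=\{X=Y=0\}\subset M$, which in these coordinates is the plane $Y=0$; its slow part $\mathcal C_s$ is $\{Y=0,\ t<0\}$ and its fast part $\mathcal C_f$ is $\{Y=0,\ t>0\}$. Put $\mathcal U_s=sh(\mathcal U)\cap\mathcal C_s$, $\mathcal U_f=sh(\mathcal U)\cap\mathcal C_f$, $\mathcal U'_s=sh'(\mathcal U)\cap\mathcal C_s$, $\mathcal U'_f=sh'(\mathcal U)\cap\mathcal C_f$. The sonic' surface $Son'$ is the set of critical points of $s$ restricted to Hugoniot' curves; in coordinates $(t,z,Y)$ it is $$-2c\big((b_1+1)z^5+(b_1+4)z^3+3z\big)t+\big((b_1+1)z^4+b_1z^2-1\big)Y-2c\big((b_1-1)z^2+1\big)=0.$$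 Standing assumptions. Only points $\mathcal U$ for which $\mathcal U_s$ and $\mathcal U_f$ exist are considered, and only Hugoniot and Hugoniot' curves diffeomorphic to $\mathbb R$ (so none through the secondary bifurcation, the line along which the Hugoniot, respectively Hugoniot', curves fail to foliate $M$). The points $\mathcal U'_s,\mathcal U'_f$ appearing in L3 are presupposed to exist.
   Formalization: The formal theorem assumes that U is not on the characteristic surface (Y_0 ≠ 0); for Y_0 = 0 the point U is itself U'_s or U'_f, so L3 fails even when z_0^2 < 1/(b_1+1), e.g. b_1=2, c=1, z_0=1/2, t_0=-8/15. *)

theory Defs
  imports "HOL-Analysis.Analysis"
begin

text \<open>
  The parameters of the flux.  All constructions below depend on them through
  \<open>Q :: wave_params\<close>; \<open>c_of Q = a3 - a2\<close> is the constant \<open>c\<close>.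
\<close>

record wave_params =
  a1 :: real
  a2 :: real
  a3 :: real
  a4 :: real
  b1 :: real

definition c_of :: "wave_params \<Rightarrow> real" where
  "c_of Q = a3 Q - a2 Q"

definition flux :: "wave_params \<Rightarrow> real \<times> real \<Rightarrow> real \<times> real" where
  "flux Q = (\<lambda>(u, v).
     (v^2 / 2 + (b1 Q + 1) * (u^2 / 2) + a1 Q * u + a2 Q * v,
      u * v + a3 Q * u + a4 Q * v))"

definition Utilde :: "wave_params \<Rightarrow> real \<Rightarrow> real" where
  "Utilde Q U = b1 Q * U + a1 Q - a4 Q"

definition Vtilde :: "wave_params \<Rightarrow> real \<Rightarrow> real" where
  "Vtilde Q V = V + a2 Q"

definition Vone :: "wave_params \<Rightarrow> real \<Rightarrow> real" where
  "Vone Q V = V + a3 Q"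

text \<open>
  The direction \<open>[x : y]\<close> in the real projective line, embedded as the unit circle by
  \<open>[cos \<theta> : sin \<theta>] \<mapsto> (cos 2\<theta>, sin 2\<theta>)\<close>.  In the paper's notation \<open>Z = y / x\<close> and
  \<open>z = 1 / Z = x / y\<close>, so \<open>Z = 0\<close> is \<open>rp1 1 0\<close> and \<open>Z = \<infinity>\<close> is \<open>rp1 0 1\<close>.
\<close>

definition rp1 :: "real \<Rightarrow> real \<Rightarrow> real \<times> real" where
  "rp1 x y = ((x^2 - y^2) / (x^2 + y^2), 2 * x * y / (x^2 + y^2))"

text \<open>
  A point is \<open>((U, V), (X, Y), direction)\<close>.  Thus the wave manifold sits in
  six-dimensional Euclidean space, from which it takes its topology and smooth structure.
\<close>

type_synonym wpoint = "(real \<times> real) \<times> (real \<times> real) \<times> (real \<times> real)"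

definition left_state :: "wpoint \<Rightarrow> real \<times> real" where
  "left_state = (\<lambda>((U, V), (X, Y), d). (U + X / 2, V + Y / 2))"

definition right_state :: "wpoint \<Rightarrow> real \<times> real" where
  "right_state = (\<lambda>((U, V), (X, Y), d). (U - X / 2, V - Y / 2))"

text \<open>
  The equations \<open>Y = Z X\<close> and \<open>(1 - Z\<^sup>2) Vtilde - Z Utilde + c = 0\<close> with \<open>Z = y / x\<close>,
  multiplied by \<open>x\<close> and \<open>x\<^sup>2\<close> so that they also make sense at \<open>Z = \<infinity>\<close>.
\<close>

definition wave_manifold :: "wave_params \<Rightarrow> wpoint set" where
  "wave_manifold Q =
     {((U, V), (X, Y), rp1 x y) | U V X Y x y.
        (x, y) \<noteq> (0, 0) \<and> x * Y = y * X \<and>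
        (x^2 - y^2) * Vtilde Q V - x * y * Utilde Q U + c_of Q * x^2 = 0}"

definition Pi_plane :: "wave_params \<Rightarrow> wpoint set" where
  "Pi_plane Q = {p \<in> wave_manifold Q. snd (snd p) = rp1 1 0}"

text \<open>
  The point with coordinates \<open>(t, z, Y)\<close>: here \<open>X = z Y\<close>, the direction is \<open>[z : 1]\<close>, and
  \<open>U\<close>, \<open>V\<close> are solved from the formulas for \<open>Utilde\<close> and \<open>Vone\<close>.
\<close>

definition wave_chart :: "wave_params \<Rightarrow> real \<Rightarrow> real \<Rightarrow> real \<Rightarrow> wpoint" where
  "wave_chart Q t z Y =
     (let ut = 2 * c_of Q * z / (z^2 + 1) + c_of Q * t * (z^2 - 1);
          v1 = c_of Q / (z^2 + 1) + c_of Q * t * z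
      in (((ut - a1 Q + a4 Q) / b1 Q, v1 - a3 Q), (z * Y, Y), rp1 z 1))"

text \<open>
  The speed in the jump relation \<open>F(W) - F(W') = s (W - W')\<close> off the diagonal, and its
  extension to the whole wave manifold by continuity.
\<close>

definition jump_speed :: "wave_params \<Rightarrow> wpoint \<Rightarrow> real" where
  "jump_speed Q p =
     (THE s. flux Q (left_state p) - flux Q (right_state p)
               = s *\<^sub>R (left_state p - right_state p))"

definition shock_speed :: "wave_params \<Rightarrow> wpoint \<Rightarrow> real" where
  "shock_speed Q p =
     Lim (at p within {q \<in> wave_manifold Q. left_state q \<noteq> right_state q}) (jump_speed Q)"

definition hugoniot :: "wave_params \<Rightarrow> wpoint \<Rightarrow> wpoint set" where
  "hugoniot Q p = {q \<in> wave_manifold Q. left_state q = left_state p}"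

definition hugoniot' :: "wave_params \<Rightarrow> wpoint \<Rightarrow> wpoint set" where
  "hugoniot' Q p = {q \<in> wave_manifold Q. right_state q = right_state p}"

definition characteristic :: "wave_params \<Rightarrow> wpoint set" where
  "characteristic Q = {p \<in> wave_manifold Q. fst (snd p) = (0, 0)}"

definition slow_characteristic :: "wave_params \<Rightarrow> wpoint set" where
  "slow_characteristic Q = {wave_chart Q t z 0 | t z. t < 0}"

definition fast_characteristic :: "wave_params \<Rightarrow> wpoint set" where
  "fast_characteristic Q = {wave_chart Q t z 0 | t z. t > 0}"

text \<open>
  Criticality of the speed restricted to a Hugoniot' curve is tested on all curves in it that
  are differentiable at the point.
\<close>

definition sonic' :: "wave_params \<Rightarrow> wpoint set" where
  "sonic' Q =
     {p \<in> wave_manifold Q. \<forall>\<gamma> :: real \<Rightarrow> wpoint.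
        \<gamma> 0 = p \<longrightarrow> range \<gamma> \<subseteq> hugoniot' Q p \<longrightarrow> \<gamma> differentiable (at 0) \<longrightarrow>
        ((\<lambda>\<tau>. shock_speed Q (\<gamma> \<tau>)) has_real_derivative 0) (at 0)}"

text \<open>
  \<open>S\<close> is the image of a smooth embedding of the real line; \<open>D n\<close> is the \<open>n\<close>-th derivative of
  the embedding \<open>D 0\<close>.
\<close>

definition diffeomorphic_to_line :: "'a::euclidean_space set \<Rightarrow> bool" where
  "diffeomorphic_to_line S \<longleftrightarrow>
     (\<exists>D :: nat \<Rightarrow> real \<Rightarrow> 'a.
        (\<forall>n \<tau>. (D n has_vector_derivative D (Suc n) \<tau>) (at \<tau>)) \<and>
        (\<forall>\<tau>. D 1 \<tau> \<noteq> 0) \<and>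
        (\<exists>g. homeomorphism UNIV S (D 0) g))"

end

theory Submission imports Defs
begin

text \<open>
  Every point of the wave manifold off the plane \<open>Z = 0\<close> has the form \<open>finite_point U V z Y\<close>, and
  there the shock speed is \<open>U + a4 + z V\<^sub>1\<close>.  A Hugoniot' curve is determined by the values
  \<open>A\<close>, \<open>B\<close> of \<open>V\<^sub>1\<close>, \<open>Utilde\<close> at the fixed right state \<open>(u', v')\<close>; off that plane it is a graph
  over \<open>z\<close>, with \<open>Y = 2 q(z) / (1 + (b\<^sub>1 - 1) z\<^sup>2)\<close> and \<open>q(z) = A z\<^sup>2 - B z + c - A\<close>, and its speed is
  \<open>u' + a4 + w\<close> with \<open>w = z (A + Y)\<close>.  At its slow and fast characteristic points \<open>z\<close> is the root
  of \<open>q\<close> with \<open>q' < 0\<close> and \<open>q' > 0\<close> respectively, so the two speeds correspond to the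
  roots of \<open>r(w) = w\<^sup>2 - B w + A (c - A)\<close> and condition L3 says \<open>r(w) < 0\<close>.  The sonic' equation
  turns this into \<open>2 r(w) = Y\<^sup>2 ((b\<^sub>1 + 1) z\<^sup>2 - 1)\<close>.
\<close>

section \<open>Points with finite \<open>z\<close> and their shock speed\<close>

definition finite_point :: "real \<Rightarrow> real \<Rightarrow> real \<Rightarrow> real \<Rightarrow> wpoint" where
  "finite_point U V z Y = ((U, V), (z * Y, Y), rp1 z 1)"

definition wave_relation :: "wave_params \<Rightarrow> real \<Rightarrow> real \<Rightarrow> real \<Rightarrow> bool" where
  "wave_relation Q U V z \<longleftrightarrow> (z^2 - 1) * Vone Q V - z * Utilde Q U + c_of Q = 0"

lemma square_plus_one_nonzero: "z^2 + 1 \<noteq> (0::real)"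
  using zero_le_power2[of z] by linarith

lemma left_state_finite_point [simp]:
  "left_state (finite_point U V z Y) = (U + z * Y / 2, V + Y / 2)"
  by (simp add: left_state_def finite_point_def)

lemma right_state_finite_point [simp]:
  "right_state (finite_point U V z Y) = (U - z * Y / 2, V - Y / 2)"
  by (simp add: right_state_def finite_point_def)

lemma finite_point_in_wave_manifold:
  assumes "wave_relation Q U V z"
  shows "finite_point U V z Y \<in> wave_manifold Q"
proof -
  have "(z^2 - 1^2) * Vtilde Q V - z * 1 * Utilde Q U + c_of Q * z^2 = 0"
    using assms by (simp add: wave_relation_def Vone_def Vtilde_def c_of_def algebra_simps)
  moreover have "z * Y = 1 * (z * Y)" "(z, 1::real) \<noteq> (0, 0)"
    by simp_all
  ultimately show ?thesis
    unfolding wave_manifold_def finite_point_def by blast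
qed

lemma rp1_dehomogenize:
  assumes "y \<noteq> 0"
  shows "rp1 x y = rp1 (x / y) 1"
proof -
  define z where "z = x / y"
  have x: "x = y * z" using assms by (simp add: z_def)
  have scaled: "x^2 - y^2 = y^2 * (z^2 - 1)" "x^2 + y^2 = y^2 * (z^2 + 1)" "2 * x * y = y^2 * (2 * z)"
    by (simp_all add: x algebra_simps power2_eq_square)
  show ?thesis
    unfolding z_def[symmetric] by (simp only: rp1_def scaled) (simp add: assms)
qed

text \<open>The first coordinate of \<open>rp1 x y\<close> equals 1 exactly when
  \<open>y = 0\<close>, that is \<open>Z = 0\<close>. Otherwise the manifold equation may be divided
  by \<open>y^2\<close>, which yields \<open>wave_relation\<close>.\<close>

lemma wave_manifold_finite_pointE:
  assumes "p \<in> wave_manifold Q" and "fst (snd (snd p)) \<noteq> 1"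
  obtains U V z Y where "p = finite_point U V z Y" "wave_relation Q U V z"
proof -
  obtain U V X Y x y where p: "p = ((U, V), (X, Y), rp1 x y)"
    and xy: "(x, y) \<noteq> (0, 0)" "x * Y = y * X"
    and eq: "(x^2 - y^2) * Vtilde Q V - x * y * Utilde Q U + c_of Q * x^2 = 0"
    using assms(1) unfolding wave_manifold_def by blast
  have y: "y \<noteq> 0"
    using assms(2) xy(1) by (auto simp: p rp1_def)
  have "X = x / y * Y"
    using xy(2) y by (simp add: field_simps)
  then have "p = finite_point U V (x / y) Y"
    by (simp add: p finite_point_def rp1_dehomogenize[OF y])
  moreover have "y^2 * (((x/y)^2 - 1) * Vone Q V - x/y * Utilde Q U + c_of Q) = 0"
    using eq y by (simp add: Vone_def Vtilde_def c_of_def field_simps power2_eq_square)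
  then have "wave_relation Q U V (x / y)"
    using y by (simp add: wave_relation_def)
  ultimately show thesis by (rule that)
qed

text \<open>The second flux component alone gives the speed after division by \<open>Y\<close>; the
  wave relation makes the first component \<open>z\<close> times the second, so the jump relation is
  consistent.\<close>

lemma jump_speed_finite_point:
  assumes rel: "wave_relation Q U V z" and "Y \<noteq> 0"
  shows "jump_speed Q (finite_point U V z Y) = U + a4 Q + z * (V + a3 Q)"
proof -
  let ?p = "finite_point U V z Y" and ?s = "U + a4 Q + z * (V + a3 Q)"
  have "Vtilde Q V + Utilde Q U * z - Vone Q V * z^2 = 0"
    using rel by (simp add: wave_relation_def Vone_def Vtilde_def c_of_def algebra_simps)
  then have s: "V + (b1 Q + 1) * U * z + a1 Q * z + a2 Q = ?s * z"
    by (simp add: Vone_def Vtilde_def Utilde_def algebra_simps power2_eq_square)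
  have "fst (flux Q (left_state ?p) - flux Q (right_state ?p))
      = (V + (b1 Q + 1) * U * z + a1 Q * z + a2 Q) * Y"
    by (simp add: flux_def field_simps power2_eq_square)
  moreover have "snd (flux Q (left_state ?p) - flux Q (right_state ?p)) = ?s * Y"
    by (simp add: flux_def algebra_simps add_divide_distrib diff_divide_distrib)
  ultimately have flux: "flux Q (left_state ?p) - flux Q (right_state ?p) = (?s * z * Y, ?s * Y)"
    unfolding s by (simp add: prod_eq_iff)
  have "left_state ?p - right_state ?p = (z * Y, Y)"
    by simp
  then have "flux Q (left_state ?p) - flux Q (right_state ?p)
      = s *\<^sub>R (left_state ?p - right_state ?p) \<longleftrightarrow> s = ?s" for s
    using \<open>Y \<noteq> 0\<close> unfolding flux by auto
  then show ?thesis
    unfolding jump_speed_def by (intro the_equality) blast+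
qed

text \<open>\<open>z = d\<^sub>2 / (1 - d\<^sub>1)\<close> recovers \<open>z\<close> from the embedded direction \<open>d\<close>.\<close>

definition speed_extension :: "wave_params \<Rightarrow> wpoint \<Rightarrow> real" where
  "speed_extension Q p = fst (fst p) + a4 Q
     + snd (snd (snd p)) / (1 - fst (snd (snd p))) * (snd (fst p) + a3 Q)"

lemma speed_extension_finite_point:
  "speed_extension Q (finite_point U V z Y) = U + a4 Q + z * (V + a3 Q)"
proof -
  have "1 - (z^2 - 1) / (z^2 + 1) = 2 / (z^2 + 1)"
    using square_plus_one_nonzero[of z] by (simp add: field_simps)
  then show ?thesis
    using square_plus_one_nonzero[of z]
    by (simp add: speed_extension_def finite_point_def rp1_def)
qed

text \<open>\<open>speed_extension\<close> is continuous off \<open>Z = 0\<close> and agrees with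
  the jump speed at nearby off-diagonal points, so it supplies the limit, also on the characteristic
  surface.\<close>

lemma shock_speed_finite_point:
  assumes rel: "wave_relation Q U V z"
  shows "shock_speed Q (finite_point U V z Y) = U + a4 Q + z * (V + a3 Q)"
proof -
  let ?p = "finite_point U V z Y"
  let ?E = "{q \<in> wave_manifold Q. left_state q \<noteq> right_state q}"
  have d1: "fst (snd (snd ?p)) \<noteq> 1"
    using square_plus_one_nonzero[of z] by (simp add: finite_point_def rp1_def field_simps)
  have "isCont (\<lambda>q::wpoint. fst (snd (snd q))) ?p"
    by (intro continuous_intros)
  then have "\<forall>\<^sub>F q in at ?p within ?E. fst (snd (snd q)) \<noteq> 1"
    using tendsto_imp_eventually_ne[OF tendsto_within_subset[OF _ subset_UNIV] d1]
    unfolding isCont_def by blast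
  moreover have "\<forall>\<^sub>F q in at ?p within ?E. q \<in> ?E"
    by (simp add: eventually_at_filter)
  ultimately have ev: "\<forall>\<^sub>F q in at ?p within ?E. speed_extension Q q = jump_speed Q q"
  proof eventually_elim
    case (elim q)
    then obtain U' V' z' Y' where q: "q = finite_point U' V' z' Y'" "wave_relation Q U' V' z'"
      using wave_manifold_finite_pointE by blast
    with elim(2) have "Y' \<noteq> 0" by auto
    with q show ?case by (simp add: speed_extension_finite_point jump_speed_finite_point)
  qed
  have "isCont (speed_extension Q) ?p"
    unfolding speed_extension_def using d1 by (intro continuous_intros) auto
  then have "(speed_extension Q \<longlongrightarrow> speed_extension Q ?p) (at ?p within ?E)"
    unfolding isCont_def by (rule tendsto_within_subset) simp
  then have "(jump_speed Q \<longlongrightarrow> speed_extension Q ?p) (at ?p within ?E)"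
    using ev by (rule Lim_transform_eventually)
  \<comment> \<open>\<open>Lim\<close> is determined only along a nontrivial filter. The wave
    relation does not involve \<open>Y\<close>, so varying \<open>Y\<close> alone stays in the
    manifold and approaches the point off the diagonal.\<close>
  moreover have "\<not> trivial_limit (at ?p within ?E)"
  proof -
    let ?f = "\<lambda>y. finite_point U V z y"
    have "(?f \<longlongrightarrow> ?p) (at Y)"
      unfolding finite_point_def by (intro tendsto_intros)
    moreover have "\<forall>\<^sub>F y in at Y. y \<noteq> 0"
      by (rule eventually_neq_at_within)
    then have "\<forall>\<^sub>F y in at Y. ?f y \<in> ?E \<and> ?f y \<noteq> ?p"
      using eventually_neq_at_within[of Y Y UNIV]
      by eventually_elim
        (use finite_point_in_wave_manifold[OF rel] in \<open>auto simp: finite_point_def left_state_def right_state_def\<close>)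
    ultimately have "filterlim ?f (at ?p within ?E) (at Y)"
      unfolding filterlim_at by blast
    then show ?thesis
      by (metis filterlim_def filtermap_bot_iff trivial_limit_at bot.extremum_uniqueI)
  qed
  ultimately show ?thesis
    unfolding shock_speed_def speed_extension_finite_point
    by (simp add: tendsto_Lim)
qed

text \<open>For fixed \<open>z\<close> the wave relation is a linear equation in
  \<open>(Utilde, Vone)\<close>; \<open>t\<close> parametrizes its solution line, with direction
  \<open>c (z^2 - 1, z)\<close>.\<close>

lemma wave_chart_finite_point:
  assumes "b1 Q \<noteq> 0"
  obtains U V where "wave_chart Q t z Y = finite_point U V z Y" "wave_relation Q U V z"
    "Utilde Q U = 2 * c_of Q * z / (z^2 + 1) + c_of Q * t * (z^2 - 1)"
    "Vone Q V = c_of Q / (z^2 + 1) + c_of Q * t * z"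
proof -
  let ?U = "(2 * c_of Q * z / (z^2 + 1) + c_of Q * t * (z^2 - 1) - a1 Q + a4 Q) / b1 Q"
  let ?V = "c_of Q / (z^2 + 1) + c_of Q * t * z - a3 Q"
  have u: "Utilde Q ?U = 2 * c_of Q * z / (z^2 + 1) + c_of Q * t * (z^2 - 1)"
    using assms by (simp add: Utilde_def)
  have v: "Vone Q ?V = c_of Q / (z^2 + 1) + c_of Q * t * z"
    by (simp add: Vone_def)
  have "wave_relation Q ?U ?V z"
  proof -
    define r where "r = 1 / (z^2 + 1)"
    have r: "r * (z^2 + 1) = 1" "c_of Q / (z^2 + 1) = c_of Q * r"
      "2 * c_of Q * z / (z^2 + 1) = 2 * c_of Q * z * r"
      using square_plus_one_nonzero[of z] by (simp_all add: r_def)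
    have "(z^2 - 1) * (c_of Q * r + c_of Q * t * z)
        - z * (2 * c_of Q * z * r + c_of Q * t * (z^2 - 1)) + c_of Q
      = c_of Q * (1 - r * (z^2 + 1))"
      by (simp add: algebra_simps power2_eq_square)
    then show ?thesis
      unfolding wave_relation_def u v unfolding r by simp
  qed
  moreover have "wave_chart Q t z Y = finite_point ?U ?V z Y"
    by (simp add: wave_chart_def finite_point_def Let_def)
  ultimately show thesis
    using u v that by blast
qed

section \<open>The sonic' equation along a Hugoniot' curve\<close>

lemma quadratic_weight_pos:
  fixes b :: real assumes "b > 1" shows "1 + (b - 1) * z^2 > 0"
  using assms by (simp add: add_pos_nonneg)

lemma sonic'_equation:
  assumes b: "b1 Q > 1" and rel: "wave_relation Q U V z"
    and sonic: "finite_point U V z Y \<in> sonic' Q"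
    and A: "A = Vone Q (V - Y / 2)"
  shows "A * (2 * z^2 + 2 + (1 + (b1 Q - 1) * z^2)) + 2 * Y = 2 * c_of Q"
proof -
  define B where "B = Utilde Q (U - z * Y / 2)"
  define D where "D = (\<lambda>\<zeta>::real. 1 + (b1 Q - 1) * \<zeta>^2)"
  define q where "q = (\<lambda>\<zeta>. A * \<zeta>^2 - B * \<zeta> + c_of Q - A)"
  define y where "y = (\<lambda>\<zeta>. 2 * q \<zeta> / D \<zeta>)"
  have D: "D \<zeta> > 0" for \<zeta>
    unfolding D_def by (rule quadratic_weight_pos[OF b])
  then have D0: "D \<zeta> \<noteq> 0" for \<zeta> by (metis less_irrefl)
  have qz: "2 * q z = Y * D z"
    using rel unfolding q_def D_def A B_def wave_relation_def Vone_def Utilde_def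
    by (simp add: field_simps power2_eq_square)
  then have yz: "y z = Y"
    unfolding y_def using D0[of z] by simp
  \<comment> \<open>With the right state fixed, the left side of the wave relation is
    \<open>q - Y D / 2\<close>, hence the choice of \<open>y\<close>. Positivity of \<open>D\<close>
    defines it for every parameter, as the range condition on the test curve requires.\<close>
  have rel': "wave_relation Q (U - z * Y / 2 + \<zeta> * y \<zeta> / 2) (V - Y / 2 + y \<zeta> / 2) \<zeta>" for \<zeta>
  proof -
    have coords: "Utilde Q (U - z * Y / 2 + \<zeta> * y \<zeta> / 2) = B + b1 Q * \<zeta> * y \<zeta> / 2"
      "Vone Q (V - Y / 2 + y \<zeta> / 2) = A + y \<zeta> / 2"
      by (simp_all add: A B_def Utilde_def Vone_def algebra_simps)
    have "2 * q \<zeta> = y \<zeta> * D \<zeta>"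
      using D0[of \<zeta>] by (simp add: y_def)
    then show ?thesis
      unfolding wave_relation_def coords
      by (simp add: q_def D_def field_simps power2_eq_square)
  qed
  define \<gamma> where "\<gamma> = (\<lambda>\<tau>. let \<zeta> = z + \<tau> in
    finite_point (U - z * Y / 2 + \<zeta> * y \<zeta> / 2) (V - Y / 2 + y \<zeta> / 2) \<zeta> (y \<zeta>))"
  have "\<gamma> 0 = finite_point U V z Y"
    by (simp add: \<gamma>_def yz)
  moreover have "range \<gamma> \<subseteq> hugoniot' Q (finite_point U V z Y)"
    using finite_point_in_wave_manifold[OF rel'] by (auto simp: hugoniot'_def \<gamma>_def Let_def)
  moreover have "\<gamma> differentiable (at 0)"
    unfolding \<gamma>_def Let_def finite_point_def rp1_def y_def q_def
    using D0[of z] square_plus_one_nonzero[of z]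
    by (auto intro!: derivative_intros differentiable_Pair simp: D_def)
  ultimately have "((\<lambda>\<tau>. shock_speed Q (\<gamma> \<tau>)) has_real_derivative 0) (at 0)"
    using sonic unfolding sonic'_def by blast
  moreover have "shock_speed Q (\<gamma> \<tau>)
      = U - z * Y / 2 + a4 Q + (z + \<tau>) * (A + y (z + \<tau>))" for \<tau>
    unfolding \<gamma>_def Let_def shock_speed_finite_point[OF rel']
    by (simp add: A Vone_def field_simps)
  ultimately have
    "((\<lambda>\<tau>. U - z * Y / 2 + a4 Q + (z + \<tau>) * (A + y (z + \<tau>))) has_real_derivative 0) (at 0)"
    by simp
  moreover have "((\<lambda>\<tau>. U - z * Y / 2 + a4 Q + (z + \<tau>) * (A + y (z + \<tau>))) has_real_derivative
      A + Y + z * ((2 * (2 * A * z - B) * D z - 2 * q z * (2 * (b1 Q - 1) * z)) / (D z * D z))) (at 0)"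
    unfolding yz[symmetric] y_def q_def D_def
    using D0[of z, unfolded D_def]
    by (auto intro!: derivative_eq_intros) (simp add: algebra_simps)
  ultimately have
    "A + Y + z * ((2 * (2 * A * z - B) * D z - 2 * q z * (2 * (b1 Q - 1) * z)) / (D z * D z)) = 0"
    using DERIV_unique by blast
  \<comment> \<open>Inserting \<open>2 q = Y D\<close> lets one factor \<open>D z\<close> cancel
    from the quotient rule.\<close>
  moreover have "2 * (2 * A * z - B) * D z - Y * D z * (2 * (b1 Q - 1) * z)
      = D z * (2 * (2 * A * z - B) - Y * (2 * (b1 Q - 1) * z))"
    by (simp add: algebra_simps)
  ultimately have "A + Y + z * ((2 * (2 * A * z - B) - Y * (2 * (b1 Q - 1) * z)) / D z) = 0"
    unfolding qz using D0[of z] by simp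
  then have "(A + Y) * D z + z * (2 * (2 * A * z - B) - Y * (2 * (b1 Q - 1) * z)) = 0"
    using D0[of z] by (simp add: field_simps)
  \<comment> \<open>The same relation expresses \<open>z B\<close> through \<open>A\<close>,
    \<open>Y\<close> and \<open>c\<close>, which removes \<open>B\<close>.\<close>
  with qz show ?thesis
    by (simp add: q_def D_def algebra_simps power2_eq_square)
qed

section \<open>Characteristic points as roots, and condition L3\<close>

lemma characteristic_root:
  assumes "b1 Q \<noteq> 0" and "right_state (wave_chart Q t z 0) = (u, v)"
    and A: "A = Vone Q v" and B: "B = Utilde Q u"
  shows "A * z^2 - B * z + c_of Q - A = 0"
    and "2 * A * z - B = c_of Q * t * (z^2 + 1)"
    and "shock_speed Q (wave_chart Q t z 0) = u + a4 Q + A * z"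
proof -
  obtain U V where p: "wave_chart Q t z 0 = finite_point U V z 0" and rel: "wave_relation Q U V z"
    and coords: "Utilde Q U = 2 * c_of Q * z / (z^2 + 1) + c_of Q * t * (z^2 - 1)"
    "Vone Q V = c_of Q / (z^2 + 1) + c_of Q * t * z"
    using wave_chart_finite_point[OF assms(1)] .
  have UV: "U = u" "V = v"
    using assms(2) by (simp_all add: p)
  show "A * z^2 - B * z + c_of Q - A = 0"
    using rel by (simp add: UV A B wave_relation_def algebra_simps)
  \<comment> \<open>At \<open>Y = 0\<close> the state \<open>(U, V)\<close> is the right state
    itself, so the chart formulas give \<open>A\<close> and \<open>B\<close>. For
    \<open>c > 0\<close>, the sign of \<open>t\<close> is thus the sign of the slope of
    \<open>q\<close> at its root.\<close>
  show "2 * A * z - B = c_of Q * t * (z^2 + 1)"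
  proof -
    have "2 * c_of Q * z / (z^2 + 1) = 2 * z * (c_of Q / (z^2 + 1))"
      by simp
    then show ?thesis
      using coords by (simp only: UV A B) (simp add: algebra_simps power2_eq_square)
  qed
  show "shock_speed Q (wave_chart Q t z 0) = u + a4 Q + A * z"
    using rel by (simp add: p UV A Vone_def shock_speed_finite_point algebra_simps)
qed

text \<open>Vieta's formulas factor the quadratic in \<open>w\<close> with roots
  \<open>A * zs\<close> and \<open>A * zf\<close>. The slope at \<open>zs\<close> is
  \<open>A (zs - zf)\<close>, so the slope signs order these roots whatever the sign of
  \<open>A\<close>.\<close>

lemma between_roots_iff:
  fixes A B C w :: real
  assumes s: "A * zs^2 - B * zs + C = 0" "2 * A * zs - B < 0"
    and f: "A * zf^2 - B * zf + C = 0" "2 * A * zf - B > 0"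
  shows "A * zs < w \<and> w < A * zf \<longleftrightarrow> w^2 - B * w + A * C < 0"
proof -
  have "(zs - zf) * (A * (zs + zf) - B) = 0"
    using s(1) f(1) by (simp add: algebra_simps power2_eq_square)
  moreover have "zs \<noteq> zf"
    using s(2) f(2) by auto
  ultimately have B: "B = A * (zs + zf)" by simp
  have C: "C = A * zs * zf"
    using s(1) by (simp add: B algebra_simps power2_eq_square)
  have "w^2 - B * w + A * C = (w - A * zs) * (w - A * zf)"
    by (simp add: B C algebra_simps power2_eq_square)
  moreover have "A * zs < A * zf"
    using s(2) by (simp add: B algebra_simps)
  ultimately show ?thesis
    by (auto simp: mult_less_0_iff)
qed

lemma square_less_inverse_iff:
  fixes m z :: real
  assumes "m > 0"
  shows "z^2 < 1 / m \<longleftrightarrow> - (1 / sqrt m) < z \<and> z < 1 / sqrt m"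
proof -
  have "z^2 < 1 / m \<longleftrightarrow> \<bar>z\<bar> < sqrt (1 / m)"
    by (metis real_sqrt_abs real_sqrt_less_iff)
  then show ?thesis
    by (auto simp: real_sqrt_divide abs_less_iff)
qed

theorem mainTheorem5:
  fixes Q :: wave_params and t0 z0 Y0 :: real and P Ps' Pf' :: wpoint
  assumes "b1 Q > 1" and "c_of Q > 0"
    and "P = wave_chart Q t0 z0 Y0"
    and "P \<in> sonic' Q - Pi_plane Q"
    and "P \<notin> characteristic Q"
    and "hugoniot Q P \<inter> slow_characteristic Q \<noteq> {}"
    and "hugoniot Q P \<inter> fast_characteristic Q \<noteq> {}"
    and "diffeomorphic_to_line (hugoniot Q P)"
    and "diffeomorphic_to_line (hugoniot' Q P)"
    and "Ps' \<in> hugoniot' Q P \<inter> slow_characteristic Q"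
    and "Pf' \<in> hugoniot' Q P \<inter> fast_characteristic Q"
  shows "(shock_speed Q Ps' < shock_speed Q P \<and> shock_speed Q P < shock_speed Q Pf'
            \<longleftrightarrow> z0^2 < 1 / (b1 Q + 1)) \<and>
         (z0^2 < 1 / (b1 Q + 1)
            \<longleftrightarrow> - (1 / sqrt (b1 Q + 1)) < z0 \<and> z0 < 1 / sqrt (b1 Q + 1))"
proof -
  let ?b = "b1 Q" and ?c = "c_of Q"
  have b0: "?b \<noteq> 0" using assms(1) by simp
  obtain U V where P: "P = finite_point U V z0 Y0" and rel: "wave_relation Q U V z0"
    using wave_chart_finite_point[OF b0] assms(3) by metis
  define A where "A = Vone Q (V - Y0 / 2)"
  define B where "B = Utilde Q (U - z0 * Y0 / 2)"
  define w where "w = z0 * (A + Y0)"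
  define r where "r = w^2 - B * w + A * (?c - A)"
  have right: "right_state P = (U - z0 * Y0 / 2, V - Y0 / 2)"
    by (simp add: P)
  obtain ts zs where Ps: "Ps' = wave_chart Q ts zs 0" "ts < 0"
    and rs: "right_state Ps' = (U - z0 * Y0 / 2, V - Y0 / 2)"
    using assms(10) right by (auto simp: hugoniot'_def slow_characteristic_def)
  obtain tf zf where Pf: "Pf' = wave_chart Q tf zf 0" "tf > 0"
    and rf: "right_state Pf' = (U - z0 * Y0 / 2, V - Y0 / 2)"
    using assms(11) right by (auto simp: hugoniot'_def fast_characteristic_def)
  note slow = characteristic_root[OF b0 rs[unfolded Ps(1)] A_def B_def, folded Ps(1)]
  note fast = characteristic_root[OF b0 rf[unfolded Pf(1)] A_def B_def, folded Pf(1)]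
  have pos: "zs^2 + 1 > 0" "zf^2 + 1 > 0"
    by (simp_all add: add_nonneg_pos)
  have "2 * A * zs - B < 0" "2 * A * zf - B > 0"
    unfolding slow(2) fast(2) using assms(2) Ps(2) Pf(2) pos
    by (simp_all add: mult_less_0_iff zero_less_mult_iff)
  then have between: "A * zs < w \<and> w < A * zf \<longleftrightarrow> r < 0"
    unfolding r_def using slow(1) fast(1) by (intro between_roots_iff) simp_all
  have speed: "shock_speed Q P = U - z0 * Y0 / 2 + a4 Q + w"
    unfolding P shock_speed_finite_point[OF rel]
    by (simp add: w_def A_def Vone_def algebra_simps)
  \<comment> \<open>On the characteristic surface \<open>r\<close> would vanish and the strict
    inequalities would fail.\<close>
  have "Y0 \<noteq> 0"
    using assms(4,5) by (auto simp: characteristic_def sonic'_def P finite_point_def)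
  have curve: "2 * (z0 * B) = 2 * (A * z0^2 + ?c - A) - Y0 * (1 + (?b - 1) * z0^2)"
    using rel unfolding A_def B_def wave_relation_def Vone_def Utilde_def
    by (simp add: field_simps power2_eq_square)
  have sonic: "2 * ?c = A * (2 * z0^2 + 2 + (1 + (?b - 1) * z0^2)) + 2 * Y0"
    using sonic'_equation[OF assms(1) rel _ A_def] assms(4) by (simp add: P)
  \<comment> \<open>Since \<open>w\<close> has the factor \<open>z0\<close>, \<open>B\<close> enters
    only as \<open>z0 * B\<close>. Then \<open>curve\<close> eliminates \<open>B\<close> and
    \<open>sonic\<close> eliminates \<open>c\<close>.\<close>
  have "2 * r = 2 * z0^2 * (A + Y0)^2 - (A + Y0) * (2 * (z0 * B)) + A * (2 * ?c) - 2 * A^2"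
    by (simp add: r_def w_def algebra_simps power2_eq_square)
  also have "\<dots> = 2 * z0^2 * (A + Y0)^2
      - (A + Y0) * (2 * A * z0^2 + 2 * ?c - 2 * A - Y0 * (1 + (?b - 1) * z0^2))
      + A * (2 * ?c) - 2 * A^2"
    unfolding curve by (simp add: algebra_simps)
  also have "\<dots> = Y0^2 * ((?b + 1) * z0^2 - 1)"
    unfolding sonic by (simp add: algebra_simps power2_eq_square)
  finally have "r < 0 \<longleftrightarrow> Y0^2 * ((?b + 1) * z0^2 - 1) < 0"
    by (auto simp del: mult_less_0_iff)
  also have "\<dots> \<longleftrightarrow> (?b + 1) * z0^2 < 1"
    using \<open>Y0 \<noteq> 0\<close> by (simp add: mult_less_0_iff)
  also have "\<dots> \<longleftrightarrow> z0^2 < 1 / (?b + 1)"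
    using assms(1) by (simp add: field_simps)
  finally have "A * zs < w \<and> w < A * zf \<longleftrightarrow> z0^2 < 1 / (?b + 1)"
    using between by simp
  then have "shock_speed Q Ps' < shock_speed Q P \<and> shock_speed Q P < shock_speed Q Pf'
      \<longleftrightarrow> z0^2 < 1 / (?b + 1)"
    unfolding speed slow(3) fast(3) by simp
  then show ?thesis
    using square_less_inverse_iff[of "?b + 1" z0] assms(1) by simp
qed

end
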